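(* For all positive integers $p,q$, the length generating polynomials satisfy $$E_{p,q}(t)=E_{p-1,q}(t)+E_{p,q-1}(t)+\big([p+q]_t-1\big)E_{p-1,q-1}(t),$$ where $[m]_t=\frac{t^m-1}{t-1}=1+t+\cdots+t^{m-1}$.
   Context: A signed $(p,q)$-involution ($p,q\ge0$, $n=p+q$) is an involution $\pi$ of $\{1,\dots,n\}$ together with a sign $+$ or $-$ on each fixed point such that (number of $+$) $-$ (number of $-$) $=p-q$; $I^{\pm}_{p,q}$ denotes the set of them. For such $\pi$ with exactly $k$ 2-cycles, let $\ell(\pi)$ be the number of inversions of the underlying permutation $\pi\in S_n$ (pairs $i<j$ with $\pi(i)>\pi(j)$), and define the length $\mathbb{L}(\pi)=\frac{\ell(\pi)+k}{2}$. The length generating function is $E_{p,q}(t)=\sum_{\pi\in I^{\pm}_{p,q}}t^{\mathbb{L}(\pi)}$. *)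

theory Defs
  imports
    "HOL-Combinatorics.Permutations"
    "HOL-Computational_Algebra.Polynomial"
begin

definition fixed_points :: "nat \<Rightarrow> (nat \<Rightarrow> nat) \<Rightarrow> nat set" where
  "fixed_points n \<pi> = {i \<in> {1..n}. \<pi> i = i}"

text \<open>
  A signed involution is a pair \<open>(\<pi>, P)\<close>, where \<open>P\<close> is the set of fixed points carrying the
  sign \<open>+\<close>; the remaining fixed points in \<open>{1..p + q}\<close> carry the sign \<open>-\<close>.
  The identity permutation counts as an involution.
\<close>
definition signed_involutions :: "nat \<Rightarrow> nat \<Rightarrow> ((nat \<Rightarrow> nat) \<times> nat set) set" where
  "signed_involutions p q = {(\<pi>, P).
     \<pi> permutes {1..p + q} \<and> \<pi> \<circ> \<pi> = id \<and> P \<subseteq> fixed_points (p + q) \<pi> \<and>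
     int (card P) - int (card (fixed_points (p + q) \<pi> - P)) = int p - int q}"

definition inversions :: "nat \<Rightarrow> (nat \<Rightarrow> nat) \<Rightarrow> (nat \<times> nat) set" where
  "inversions n \<pi> = {(i, j). i \<in> {1..n} \<and> j \<in> {1..n} \<and> i < j \<and> \<pi> i > \<pi> j}"

text \<open>Each 2-cycle is recorded once, with its smaller element first.\<close>
definition two_cycles :: "nat \<Rightarrow> (nat \<Rightarrow> nat) \<Rightarrow> (nat \<times> nat) set" where
  "two_cycles n \<pi> = {(i, j). i \<in> {1..n} \<and> j \<in> {1..n} \<and> i < j \<and> \<pi> i = j \<and> \<pi> j = i}"

text \<open>The division is exact for involutions, see \<open>two_times_inv_length\<close> below.\<close>
definition inv_length :: "nat \<Rightarrow> (nat \<Rightarrow> nat) \<Rightarrow> nat" where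
  "inv_length n \<pi> = (card (inversions n \<pi>) + card (two_cycles n \<pi>)) div 2"

definition length_gen_poly :: "nat \<Rightarrow> nat \<Rightarrow> int poly" where
  "length_gen_poly p q = (\<Sum>(\<pi>, P) \<in> signed_involutions p q. monom 1 (inv_length (p + q) \<pi>))"

definition q_bracket :: "nat \<Rightarrow> int poly" where
  "q_bracket m = (\<Sum>i<m. monom 1 i)"

lemma q_bracket_closed_form: "(monom 1 1 - 1) * q_bracket m = monom 1 m - 1"
proof -
  have "q_bracket m = (\<Sum>i<m. monom 1 1 ^ i)"
    by (simp add: q_bracket_def monom_power)
  then show ?thesis
    using power_diff_1_eq[of "monom (1::int) 1" m] by (simp add: monom_power)
qed

lemma finite_signed_involutions: "finite (signed_involutions p q)"
proof -
  have "signed_involutions p q \<subseteq> {\<pi>. \<pi> permutes {1..p + q}} \<times> Pow {1..p + q}"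
    by (auto simp: signed_involutions_def fixed_points_def)
  moreover have "finite ({\<pi>. \<pi> permutes {1..p + q}} \<times> Pow {1..p + q})"
    by (simp add: finite_permutations)
  ultimately show ?thesis
    by (rule finite_subset)
qed

lemma two_times_inv_length:
  assumes "\<pi> permutes {1..n}" "\<pi> \<circ> \<pi> = id"
  shows "2 * inv_length n \<pi> = card (inversions n \<pi>) + card (two_cycles n \<pi>)"
proof -
  have inv: "\<pi> (\<pi> i) = i" for i
    using assms(2) by (metis comp_apply id_apply)
  have mem: "\<pi> i \<in> {1..n} \<longleftrightarrow> i \<in> {1..n}" for i
    using assms(1) by (rule permutes_in_image)
  define A where "A = {(i, j) \<in> inversions n \<pi>. i < \<pi> j}"
  define B where "B = {(i, j) \<in> inversions n \<pi>. i > \<pi> j}"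
  have "finite (inversions n \<pi>)"
    by (rule finite_subset[of _ "{1..n} \<times> {1..n}"]) (auto simp: inversions_def)
  then have fin: "finite A" "finite B" "finite (two_cycles n \<pi>)"
    by (auto simp: A_def B_def two_cycles_def inversions_def elim: rev_finite_subset)
  have "inversions n \<pi> = (A \<union> B) \<union> two_cycles n \<pi>"
    using inv by (auto simp: A_def B_def two_cycles_def inversions_def) (metis linorder_neqE_nat)
  moreover have "(A \<union> B) \<inter> two_cycles n \<pi> = {}" "A \<inter> B = {}"
    by (auto simp: A_def B_def two_cycles_def)
  ultimately have "card (inversions n \<pi>) = card A + card B + card (two_cycles n \<pi>)"
    using fin by (simp add: card_Un_disjoint)
  moreover have "bij_betw (\<lambda>(i, j). (\<pi> j, \<pi> i)) A B"
    by (rule bij_betw_byWitness[where f' = "\<lambda>(i, j). (\<pi> j, \<pi> i)"])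
      (use inv mem in \<open>auto simp: A_def B_def inversions_def simp del: atLeastAtMost_iff\<close>)
  then have "card A = card B"
    by (rule bij_betw_same_card)
  ultimately show ?thesis
    by (simp add: inv_length_def)
qed

end

theory Submission
  imports Defs
begin

text \<open>
  Classify the signed involutions of \<open>{1..n}\<close>, \<open>n = p + q\<close>, by what happens to \<open>n\<close>. If \<open>n\<close> is a
  fixed point, deleting it does not change the length and gives the first two summands. If \<open>n\<close> is
  matched with \<open>i < n\<close>, delete the 2-cycle \<open>(i, n)\<close> and relabel: the inversions lost are \<open>(i, n)\<close>,
  the pairs \<open>(i, j)\<close> with \<open>i < j < n\<close>, and the pairs \<open>(j, n)\<close> with \<open>i < \<pi> j < n\<close>, that is
  \<open>2 (n - 1 - i) + 1\<close> of them, so the length drops by exactly \<open>n - i\<close>. Summing \<open>t ^ (n - i)\<close> over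
  \<open>i\<close> gives the factor \<open>[n] - 1\<close>.
\<close>

text \<open>An involution is its own inverse, so the unique preimages demanded by
  \<open>permutes\<close> come for free. This pointwise form is the one assumed in
  \<open>cycle_insertion\<close>.\<close>

lemma involution_permutes_iff:
  "\<pi> permutes S \<and> \<pi> \<circ> \<pi> = id \<longleftrightarrow> (\<forall>x. \<pi> (\<pi> x) = x) \<and> (\<forall>x. x \<notin> S \<longrightarrow> \<pi> x = x)"
  unfolding permutes_def fun_eq_iff comp_apply id_apply by metis

section \<open>Relabelling around an omitted value\<close>

text \<open>The increasing enumeration of all naturals other than \<open>i\<close>;
  \<open>unskip i\<close> is its left inverse, with an arbitrary value at \<open>i\<close>
  itself.\<close>

definition skip :: "nat \<Rightarrow> nat \<Rightarrow> nat" where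
  "skip i x = (if x < i then x else Suc x)"

definition unskip :: "nat \<Rightarrow> nat \<Rightarrow> nat" where
  "unskip i x = (if x \<le> i then x else x - 1)"

lemma unskip_skip [simp]: "unskip i (skip i x) = x"
  by (auto simp: skip_def unskip_def)

lemma skip_unskip: "x \<noteq> i \<Longrightarrow> skip i (unskip i x) = x"
  by (auto simp: skip_def unskip_def)

lemma skip_neq [simp]: "skip i x \<noteq> i" "i \<noteq> skip i x"
  by (auto simp: skip_def)

lemma skip_less_iff [simp]: "skip i x < skip i y \<longleftrightarrow> x < y"
  by (auto simp: skip_def)

lemma skip_eq_iff [simp]: "skip i x = skip i y \<longleftrightarrow> x = y"
  by (auto simp: skip_def)

lemma inj_skip: "inj (skip i)"
  by (simp add: inj_def)

text \<open>This singles out \<open>Suc m\<close> as the one label outside \<open>{1..m}\<close>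
  that relabelling sends to an end of the new 2-cycle; it needs separate treatment in
  \<open>insert_skip\<close> and \<open>delete_cycle\<close>.\<close>

lemma skip_eq_top_iff: "i \<le> Suc m \<Longrightarrow> skip i x = Suc (Suc m) \<longleftrightarrow> x = Suc m"
  by (auto simp: skip_def)

lemma skip_cases:
  assumes "x \<in> {1..Suc (Suc m)}" "i \<in> {1..Suc m}"
  obtains "x = i" | "x = Suc (Suc m)" | z where "x = skip i z" "z \<in> {1..m}"
proof (cases "x = i \<or> x = Suc (Suc m)")
  case True
  then show ?thesis using that by blast
next
  case False
  then have "x = skip i (unskip i x)" "unskip i x \<in> {1..m}"
    using assms by (auto simp: skip_unskip) (auto simp: unskip_def)
  then show ?thesis using that by blast
qed

section \<open>Inserting and deleting a 2-cycle through the largest element\<close>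

text \<open>
  \<open>\<sigma>\<close> acts on \<open>{1..m}\<close>; it is relabelled to \<open>{1..m + 2} - {i, m + 2}\<close> by the increasing bijection.
\<close>
definition insert_cycle :: "nat \<Rightarrow> nat \<Rightarrow> (nat \<Rightarrow> nat) \<Rightarrow> nat \<Rightarrow> nat" where
  "insert_cycle m i \<sigma> x =
     (if x = i then Suc (Suc m) else if x = Suc (Suc m) then i else skip i (\<sigma> (unskip i x)))"

text \<open>When \<open>i\<close> is the partner of \<open>Suc (Suc m)\<close>, the general formula
  at \<open>Suc m\<close> would return \<open>unskip i i = i\<close>. The extra branch makes
  \<open>Suc m\<close> a fixed point instead, as \<open>cycle_insertion\<close> requires outside
  \<open>{1..m}\<close>.\<close>

definition delete_cycle :: "nat \<Rightarrow> nat \<Rightarrow> (nat \<Rightarrow> nat) \<Rightarrow> nat \<Rightarrow> nat" where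
  "delete_cycle m i \<pi> x = (if x = Suc m then x else unskip i (\<pi> (skip i x)))"

locale cycle_insertion =
  fixes m i :: nat and \<sigma> :: "nat \<Rightarrow> nat"
  assumes i: "i \<in> {1..Suc m}"
    and invol: "\<sigma> (\<sigma> x) = x"
    and outside: "x \<notin> {1..m} \<Longrightarrow> \<sigma> x = x"
begin

abbreviation "\<pi> \<equiv> insert_cycle m i \<sigma>"

lemma mem_iff: "\<sigma> x \<in> {1..m} \<longleftrightarrow> x \<in> {1..m}"
  by (metis invol outside)

lemma insert_left [simp]: "\<pi> i = Suc (Suc m)"
  by (simp add: insert_cycle_def)

lemma insert_top [simp]: "\<pi> (Suc (Suc m)) = i"
  by (simp add: insert_cycle_def)

lemma insert_skip [simp]: "x \<noteq> Suc m \<Longrightarrow> \<pi> (skip i x) = skip i (\<sigma> x)"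
  using i by (simp add: insert_cycle_def skip_eq_top_iff)

lemma sigma_eq_Suc_iff: "\<sigma> x = Suc m \<longleftrightarrow> x = Suc m"
  using invol[of x] outside[of "Suc m"] by auto

lemma insert_invol: "\<pi> (\<pi> x) = x"
proof (cases "x = i \<or> x = Suc (Suc m)")
  case True
  then show ?thesis by auto
next
  case False
  then have x: "x = skip i (unskip i x)" by (simp add: skip_unskip)
  moreover have "unskip i x \<noteq> Suc m"
    using False i x by (metis atLeastAtMost_iff skip_eq_top_iff)
  ultimately show ?thesis
    by (metis insert_skip invol sigma_eq_Suc_iff)
qed

lemma insert_outside:
  assumes "x \<notin> {1..Suc (Suc m)}"
  shows "\<pi> x = x"
proof -
  have "x \<noteq> i" "x \<noteq> Suc (Suc m)" "unskip i x \<notin> {1..m}"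
    using assms i by (auto simp: unskip_def split: if_splits)
  then show ?thesis
    by (simp add: insert_cycle_def outside skip_unskip)
qed

lemma skip_mem: "x \<in> {1..m} \<Longrightarrow> skip i x \<in> {1..Suc (Suc m)}"
  by (auto simp: skip_def)

lemma skip_less_top: "x \<in> {1..m} \<Longrightarrow> skip i x < Suc (Suc m)"
  by (auto simp: skip_def)

lemma insert_skip': "x \<in> {1..m} \<Longrightarrow> \<pi> (skip i x) = skip i (\<sigma> x)"
  by (rule insert_skip) auto

lemma fixed_points_insert: "fixed_points (Suc (Suc m)) \<pi> = skip i ` fixed_points m \<sigma>"
proof (intro equalityI subsetI)
  fix x assume "x \<in> fixed_points (Suc (Suc m)) \<pi>"
  then have x: "x \<in> {1..Suc (Suc m)}" "\<pi> x = x" by (auto simp: fixed_points_def)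
  from x(1) i show "x \<in> skip i ` fixed_points m \<sigma>"
    by (cases rule: skip_cases) (use i x(2) in \<open>auto simp: fixed_points_def\<close>)
next
  fix x assume "x \<in> skip i ` fixed_points m \<sigma>"
  then show "x \<in> fixed_points (Suc (Suc m)) \<pi>"
    using skip_mem insert_skip' by (auto simp: fixed_points_def simp del: atLeastAtMost_iff)
qed

lemma two_cycles_insert:
  "two_cycles (Suc (Suc m)) \<pi> =
     insert (i, Suc (Suc m)) (map_prod (skip i) (skip i) ` two_cycles m \<sigma>)" (is "?L = ?R")
proof (intro equalityI subsetI)
  fix c assume "c \<in> ?L"
  then obtain x y where c: "c = (x, y)"
    and x: "x \<in> {1..Suc (Suc m)}" and y: "y \<in> {1..Suc (Suc m)}"
    and xy: "x < y" "\<pi> x = y" "\<pi> y = x"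
    by (auto simp: two_cycles_def)
  from x i show "c \<in> ?R"
  proof (cases rule: skip_cases)
    case (3 z)
    then have "\<sigma> z \<in> {1..m}" "y = skip i (\<sigma> z)" using mem_iff xy insert_skip' by auto
    then have "(z, \<sigma> z) \<in> two_cycles m \<sigma>"
      using 3 xy invol by (auto simp: two_cycles_def)
    then show ?thesis
      using 3 \<open>y = _\<close> c by (auto intro!: image_eqI[of _ _ "(z, \<sigma> z)"])
  qed (use c y xy in auto)
next
  fix c assume "c \<in> ?R"
  then show "c \<in> ?L"
    using i skip_mem insert_skip' by (auto simp: two_cycles_def simp del: atLeastAtMost_iff)
      auto
qed

text \<open>Since \<open>skip i\<close> is increasing, it transports the old inversions. Position
  \<open>i\<close> carries the largest value, so it forms an inversion with every later position and
  none with an earlier one. The last position carries the value \<open>i\<close>, so its inversions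
  are indexed by the values \<open>v > i\<close>, the value \<open>v\<close> standing at position
  \<open>\<pi> v\<close>. The pair \<open>(i, Suc (Suc m))\<close> arises from
  \<open>v = Suc (Suc m)\<close>, which is why the middle family stops at
  \<open>Suc m\<close>.\<close>

lemma inversions_insert:
  "inversions (Suc (Suc m)) \<pi> =
     map_prod (skip i) (skip i) ` inversions m \<sigma> \<union>
     (Pair i ` {i<..Suc m} \<union> (\<lambda>v. (\<pi> v, Suc (Suc m))) ` {i<..Suc (Suc m)})"
    (is "?L = ?A \<union> (?B \<union> ?C)")
proof (intro equalityI subsetI)
  fix c assume "c \<in> ?L"
  then obtain x y where c: "c = (x, y)"
    and x: "x \<in> {1..Suc (Suc m)}" and y: "y \<in> {1..Suc (Suc m)}"
    and xy: "x < y" "\<pi> x > \<pi> y"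
    by (auto simp: inversions_def)
  consider "x = i" "y \<noteq> Suc (Suc m)" | "y = Suc (Suc m)" | "x \<noteq> i" "y \<noteq> Suc (Suc m)" by blast
  then show "c \<in> ?A \<union> (?B \<union> ?C)"
  proof cases
    case 1
    then show ?thesis using c xy y by auto
  next
    case 2
    have "\<pi> x \<in> {1..Suc (Suc m)}"
      \<comment> \<open>If \<open>\<pi> x\<close> were out of range it would be fixed, hence equal
        to \<open>x\<close>, which is in range.\<close>
      using x insert_outside[of "\<pi> x"] insert_invol[of x] by metis
    then have "c \<in> ?C"
      using 2 c xy insert_invol by (auto intro!: image_eqI[of _ _ "\<pi> x"])
    then show ?thesis by blast
  next
    case 3
    have "\<pi> x \<in> {1..Suc (Suc m)}"
      using x insert_outside[of "\<pi> x"] insert_invol[of x] by metis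
    \<comment> \<open>The value at \<open>i\<close> is the maximum, so no value to its left exceeds
      it.\<close>
    then have "y \<noteq> i" using xy by auto
    obtain u where u: "x = skip i u" "u \<in> {1..m}"
      using x i by (cases rule: skip_cases) (use 3 xy y in auto)
    obtain v where v: "y = skip i v" "v \<in> {1..m}"
      using y i by (cases rule: skip_cases) (use 3 \<open>y \<noteq> i\<close> in auto)
    have "(u, v) \<in> inversions m \<sigma>"
      using u v xy insert_skip' by (auto simp: inversions_def)
    then show ?thesis using c u v by auto
  qed
next
  fix c assume "c \<in> ?A \<union> (?B \<union> ?C)"
  then consider "c \<in> ?A" | "c \<in> ?B" | "c \<in> ?C" by blast
  then show "c \<in> ?L"
  proof cases
    case 1
    then show ?thesis
      using skip_mem insert_skip' by (auto simp: inversions_def simp del: atLeastAtMost_iff)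
  next
    case 2
    then obtain y where y: "c = (i, y)" "i < y" "y < Suc (Suc m)" by auto
    then have "y \<in> {1..Suc (Suc m)}" by auto
    then obtain v where "y = skip i v" "v \<in> {1..m}"
      using i by (cases rule: skip_cases) (use y in auto)
    then have "\<pi> y < Suc (Suc m)" using skip_less_top mem_iff insert_skip' by metis
    then show ?thesis using y i by (auto simp: inversions_def)
  next
    case 3
    then obtain v where v: "c = (\<pi> v, Suc (Suc m))" "i < v" "v \<le> Suc (Suc m)" by auto
    then have "v \<in> {1..Suc (Suc m)}" by auto
    moreover have "\<pi> v \<in> {1..Suc (Suc m)}"
      using calculation insert_outside[of "\<pi> v"] insert_invol[of v] by metis
    moreover have "\<pi> v \<noteq> Suc (Suc m)"
      using v insert_invol[of v] by auto
    ultimately show ?thesis using v insert_invol[of v] by (auto simp: inversions_def)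
  qed
qed

lemma inj_insert: "inj \<pi>"
  by (metis injI insert_invol)

text \<open>The three families are disjoint: transported pairs avoid \<open>i\<close> and
  \<open>Suc (Suc m)\<close>, and only the last family has second entry \<open>Suc (Suc m)\<close>.
  The sizes of the two new families differ by one, so their sum is odd.\<close>

lemma card_inversions_insert:
  "card (inversions (Suc (Suc m)) \<pi>) = card (inversions m \<sigma>) + (2 * (Suc m - i) + 1)"
proof -
  define A where "A = map_prod (skip i) (skip i) ` inversions m \<sigma>"
  define B where "B = Pair i ` {i<..Suc m}"
  define C where "C = (\<lambda>v. (\<pi> v, Suc (Suc m))) ` {i<..Suc (Suc m)}"
  have "finite (inversions m \<sigma>)"
    by (rule finite_subset[of _ "{1..m} \<times> {1..m}"]) (auto simp: inversions_def)
  then have fin: "finite A" "finite B" "finite C"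
    by (simp_all add: A_def B_def C_def)
  have "inj_on (map_prod (skip i) (skip i)) (inversions m \<sigma>)"
    by (auto simp: inj_on_def)
  then have cA: "card A = card (inversions m \<sigma>)"
    by (simp add: A_def card_image)
  have cB: "card B = Suc m - i"
    by (simp add: B_def card_image inj_on_def)
  have "inj_on (\<lambda>v. (\<pi> v, Suc (Suc m))) {i<..Suc (Suc m)}"
    using inj_insert by (auto simp: inj_on_def)
  then have cC: "card C = Suc (Suc m) - i"
    by (simp add: C_def card_image)
  have "A \<inter> (B \<union> C) = {}"
    using skip_less_top by (fastforce simp: A_def B_def C_def inversions_def)
  moreover have "B \<inter> C = {}"
    by (auto simp: B_def C_def)
  ultimately have "card (A \<union> (B \<union> C)) = card A + (card B + card C)"
    using fin by (simp add: card_Un_disjoint)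
  also have "\<dots> = card (inversions m \<sigma>) + (2 * (Suc m - i) + 1)"
    using i unfolding cA cB cC atLeastAtMost_iff by linarith
  finally show ?thesis
    by (simp add: inversions_insert A_def B_def C_def)
qed

lemma card_two_cycles_insert:
  "card (two_cycles (Suc (Suc m)) \<pi>) = Suc (card (two_cycles m \<sigma>))"
proof -
  have fin: "finite (two_cycles m \<sigma>)"
    by (rule finite_subset[of _ "{1..m} \<times> {1..m}"]) (auto simp: two_cycles_def)
  have "inj_on (map_prod (skip i) (skip i)) (two_cycles m \<sigma>)"
    by (auto simp: inj_on_def)
  moreover have "(i, Suc (Suc m)) \<notin> map_prod (skip i) (skip i) ` two_cycles m \<sigma>"
    by auto
  ultimately show ?thesis
    using fin by (simp add: two_cycles_insert card_image)
qed

text \<open>The odd number of new inversions and the single new 2-cycle add up to an even number, so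
  the truncating \<open>div\<close> in \<open>inv_length\<close> shifts by exactly half of
  it.\<close>

lemma inv_length_insert: "inv_length (Suc (Suc m)) \<pi> = inv_length m \<sigma> + (Suc (Suc m) - i)"
proof -
  have "card (inversions (Suc (Suc m)) \<pi>) + card (two_cycles (Suc (Suc m)) \<pi>)
      = (card (inversions m \<sigma>) + card (two_cycles m \<sigma>)) + 2 * (Suc (Suc m) - i)"
    using i unfolding card_inversions_insert card_two_cycles_insert atLeastAtMost_iff by linarith
  then show ?thesis
    by (simp only: inv_length_def div_mult_self2)
qed

text \<open>Relabelling carries fixed points injectively to fixed points and keeps their signs. Both
  sign counts are unchanged, and so is the difference of the two parameters when each grows by
  one.\<close>

lemma insert_mem_signed_involutions_iff:
  assumes "m = a + b"
  shows "(\<pi>, skip i ` Q) \<in> signed_involutions (Suc a) (Suc b) \<longleftrightarrow> (\<sigma>, Q) \<in> signed_involutions a b"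
proof -
  have "\<pi> permutes {1..Suc (Suc m)} \<and> \<pi> \<circ> \<pi> = id"
    using insert_invol insert_outside by (simp add: involution_permutes_iff)
  moreover have "\<sigma> permutes {1..m} \<and> \<sigma> \<circ> \<sigma> = id"
    using invol outside by (simp add: involution_permutes_iff)
  moreover have "skip i ` Q \<subseteq> skip i ` F \<longleftrightarrow> Q \<subseteq> F" for F
    by (rule inj_image_subset_iff[OF inj_skip])
  moreover have "card (skip i ` Q) = card Q" for Q
    by (rule card_image) (simp add: inj_on_def)
  ultimately show ?thesis
    by (simp add: signed_involutions_def assms[symmetric] fixed_points_insert
        image_set_diff[OF inj_skip, symmetric])
qed

end

text \<open>Every involution that moves its largest element arises by insertion; this supplies the
  surjectivity behind \<open>sum_matched\<close>.\<close>

lemma delete_cycle: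
  assumes "\<And>x. \<pi> (\<pi> x) = x" "\<And>x. x \<notin> {1..Suc (Suc m)} \<Longrightarrow> \<pi> x = x"
    and "\<pi> (Suc (Suc m)) = i" "i \<in> {1..Suc m}"
  shows "cycle_insertion m i (delete_cycle m i \<pi>)"
    and "insert_cycle m i (delete_cycle m i \<pi>) = \<pi>"
proof -
  let ?\<sigma> = "delete_cycle m i \<pi>"
  have pi_i: "\<pi> i = Suc (Suc m)" using assms by metis
  have skip_top: "skip i x = Suc (Suc m) \<longleftrightarrow> x = Suc m" for x
    using assms(4) by (simp add: skip_eq_top_iff)
  have \<pi>_skip: "\<pi> (skip i x) = skip i (?\<sigma> x)" if "x \<noteq> Suc m" for x
  proof -
    \<comment> \<open>Only \<open>Suc (Suc m)\<close> is sent to \<open>i\<close>, and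
      \<open>skip i x\<close> differs from it; hence \<open>skip_unskip\<close> applies to the
      image.\<close>
    have "\<pi> (skip i x) \<noteq> i" using that skip_top assms by metis
    then show ?thesis using that by (simp add: delete_cycle_def skip_unskip)
  qed
  have top: "?\<sigma> (Suc m) = Suc m" by (simp add: delete_cycle_def)
  \<comment> \<open>Otherwise \<open>\<pi>\<close> would send \<open>skip i x\<close> to
    \<open>Suc (Suc m)\<close>, forcing \<open>skip i x = i\<close>.\<close>
  have not_top: "?\<sigma> x \<noteq> Suc m" if "x \<noteq> Suc m" for x
    using \<pi>_skip[OF that] skip_top pi_i assms(1) skip_neq by metis
  show "cycle_insertion m i ?\<sigma>"
  proof
    show "i \<in> {1..Suc m}" by fact
    show "?\<sigma> (?\<sigma> x) = x" for x
      using top not_top \<pi>_skip assms(1) skip_eq_iff by metis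
    show "?\<sigma> x = x" if "x \<notin> {1..m}" for x
    proof (cases "x = Suc m")
      case False
      \<comment> \<open>Here \<open>x\<close> is \<open>0\<close> or exceeds \<open>Suc m\<close>;
        \<open>i \<ge> 1\<close> ensures that \<open>skip i\<close> fixes \<open>0\<close>.\<close>
      then have "skip i x \<notin> {1..Suc (Suc m)}"
        using that assms(4) by (auto simp: skip_def)
      then show ?thesis using False assms(2) by (simp add: delete_cycle_def)
    qed (simp add: top)
  qed
  show "insert_cycle m i ?\<sigma> = \<pi>"
  proof
    fix x
    show "insert_cycle m i ?\<sigma> x = \<pi> x"
    proof (cases "x = i \<or> x = Suc (Suc m)")
      case False
      then have "unskip i x \<noteq> Suc m" using skip_top skip_unskip by metis
      then show ?thesis using False \<pi>_skip[of "unskip i x"]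
        by (simp add: insert_cycle_def skip_unskip)
    qed (auto simp: insert_cycle_def pi_i assms(3))
  qed
qed

section \<open>Involutions fixing the largest element\<close>

text \<open>The last position carries the largest value, so it takes part in no inversion and in no
  2-cycle.\<close>

lemma inv_length_fixed_top:
  assumes "\<pi> permutes {1..n}"
  shows "inv_length (Suc n) \<pi> = inv_length n \<pi>"
proof -
  have top: "\<pi> (Suc n) = Suc n"
    using assms by (simp add: permutes_not_in)
  have le: "\<pi> x \<le> n" if "1 \<le> x" "x \<le> n" for x
    using that permutes_in_image[OF assms, of x] by simp
  have "inversions (Suc n) \<pi> = inversions n \<pi>"
    using top le by (fastforce simp: inversions_def le_Suc_eq)
  moreover have "two_cycles (Suc n) \<pi> = two_cycles n \<pi>"
    using top by (auto simp: two_cycles_def le_Suc_eq)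
  ultimately show ?thesis
    by (simp add: inv_length_def)
qed

lemma fixed_points_top:
  assumes "\<pi> permutes {1..n}"
  shows "fixed_points (Suc n) \<pi> = insert (Suc n) (fixed_points n \<pi>)"
  using permutes_not_in[OF assms, of "Suc n"] by (auto simp: fixed_points_def le_Suc_eq)

text \<open>Permutations are total functions that are the identity outside their set, so deleting a
  fixed largest element keeps the function and only shrinks the interval.\<close>

lemma permutes_fixed_top_iff:
  "\<pi> permutes {1..Suc n} \<and> \<pi> (Suc n) = Suc n \<longleftrightarrow> \<pi> permutes {1..n}"
proof
  assume "\<pi> permutes {1..Suc n} \<and> \<pi> (Suc n) = Suc n"
  then show "\<pi> permutes {1..n}"
    by (elim conjE permutes_superset) (auto simp: le_Suc_eq)
next
  assume *: "\<pi> permutes {1..n}"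
  then show "\<pi> permutes {1..Suc n} \<and> \<pi> (Suc n) = Suc n"
    using permutes_subset[OF *, of "{1..Suc n}"] permutes_not_in[OF *, of "Suc n"] by simp
qed

lemma finite_fixed_points [simp]: "finite (fixed_points n \<pi>)"
  by (simp add: fixed_points_def)

lemma Suc_notin_fixed_points [simp]: "Suc n \<notin> fixed_points n \<pi>"
  by (simp add: fixed_points_def)

text \<open>The added fixed point raises the number of plus signs by one and leaves the minus signs
  alone, matching the step from \<open>a\<close> to \<open>Suc a\<close>.\<close>

lemma fixed_plus_mem_iff:
  assumes "Suc (a + b) \<notin> Q" "\<pi> permutes {1..a + b}"
  shows "(\<pi>, insert (Suc (a + b)) Q) \<in> signed_involutions (Suc a) b \<longleftrightarrow> (\<pi>, Q) \<in> signed_involutions a b"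
proof -
  have "\<pi> permutes {1..Suc (a + b)}"
    using assms permutes_fixed_top_iff by blast
  moreover have "insert (Suc (a + b)) (fixed_points (a + b) \<pi>) - insert (Suc (a + b)) Q
      = fixed_points (a + b) \<pi> - Q"
    by auto
  moreover have "Q \<subseteq> insert (Suc (a + b)) (fixed_points (a + b) \<pi>) \<longleftrightarrow> Q \<subseteq> fixed_points (a + b) \<pi>"
    using assms(1) by auto
  moreover have "card (insert (Suc (a + b)) Q) = Suc (card Q)" if "Q \<subseteq> fixed_points (a + b) \<pi>"
    using assms(1) finite_subset[OF that] by simp
  ultimately show ?thesis
    using assms by (auto simp: signed_involutions_def fixed_points_top)
qed

text \<open>Minus signs are recorded only as the complement of \<open>Q\<close>, so a new negative
  fixed point leaves the pair itself unchanged. \<open>sum_fixed_minus\<close> can therefore use an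
  equality of sets where \<open>sum_fixed_plus\<close> needs a bijection.\<close>

lemma fixed_minus_mem_iff:
  assumes "Suc (a + b) \<notin> Q" "\<pi> permutes {1..a + b}"
  shows "(\<pi>, Q) \<in> signed_involutions a (Suc b) \<longleftrightarrow> (\<pi>, Q) \<in> signed_involutions a b"
proof -
  have "\<pi> permutes {1..Suc (a + b)}"
    using assms permutes_fixed_top_iff by blast
  moreover have "insert (Suc (a + b)) (fixed_points (a + b) \<pi>) - Q
      = insert (Suc (a + b)) (fixed_points (a + b) \<pi> - Q)"
    using assms(1) by auto
  moreover have "Q \<subseteq> insert (Suc (a + b)) (fixed_points (a + b) \<pi>) \<longleftrightarrow> Q \<subseteq> fixed_points (a + b) \<pi>"
    using assms(1) by auto
  ultimately show ?thesis
    using assms by (auto simp: signed_involutions_def fixed_points_top)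
qed

lemma signed_involutionsD:
  assumes "(\<pi>, P) \<in> signed_involutions a b"
  shows "\<pi> permutes {1..a + b}" "P \<subseteq> {1..a + b}" "\<pi> (\<pi> x) = x"
  using assms by (auto simp: signed_involutions_def fixed_points_def fun_eq_iff)

section \<open>Summation over the three classes\<close>

abbreviation weight :: "nat \<Rightarrow> (nat \<Rightarrow> nat) \<times> nat set \<Rightarrow> int poly" where
  "weight n \<equiv> \<lambda>(\<pi>, P). monom 1 (inv_length n \<pi>)"

lemma sum_fixed_plus:
  "(\<Sum>x \<in> {(\<pi>, P) \<in> signed_involutions (Suc a) b. \<pi> (Suc (a + b)) = Suc (a + b) \<and> Suc (a + b) \<in> P}.
      weight (Suc (a + b)) x) = length_gen_poly a b"
  unfolding length_gen_poly_def
\<comment> \<open>The five goals in order: \<open>i\<close> undoes \<open>j\<close>,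
  \<open>j\<close> lands in the target, \<open>j\<close> undoes \<open>i\<close>, \<open>i\<close>
  lands in the source, the weights agree.\<close>
proof (rule sum.reindex_bij_witness[where
      i = "\<lambda>(\<pi>, P). (\<pi>, insert (Suc (a + b)) P)" and j = "\<lambda>(\<pi>, P). (\<pi>, P - {Suc (a + b)})"],
      goal_cases)
  case (2 x)
  obtain \<pi> P where x: "x = (\<pi>, P)" by (cases x)
  then have "\<pi> permutes {1..a + b}" "insert (Suc (a + b)) P = P"
    using 2 signed_involutionsD(1)[of \<pi> P "Suc a" b] permutes_fixed_top_iff[of \<pi> "a + b"] by auto
  then show ?case
    using 2 x fixed_plus_mem_iff[of a b "P - {Suc (a + b)}" \<pi>] by auto
next
  case (4 x)
  obtain \<pi> P where x: "x = (\<pi>, P)" by (cases x)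
  have \<pi>: "\<pi> permutes {1..a + b}" and P: "Suc (a + b) \<notin> P"
    using 4 x signed_involutionsD(1,2)[of \<pi> P a b] by auto
  then show ?case
    using 4 x fixed_plus_mem_iff[of a b P \<pi>] permutes_fixed_top_iff[of \<pi> "a + b"] by auto
next
  case (5 x)
  obtain \<pi> P where x: "x = (\<pi>, P)" by (cases x)
  then have "\<pi> permutes {1..a + b}"
    using 5 signed_involutionsD(1)[of \<pi> P "Suc a" b] permutes_fixed_top_iff[of \<pi> "a + b"] by auto
  then show ?case using x by (simp add: inv_length_fixed_top)
next
  case (3 x)
  obtain \<pi> P where x: "x = (\<pi>, P)" by (cases x)
  then have "Suc (a + b) \<notin> P"
    using 3 signed_involutionsD(2)[of \<pi> P a b] by auto
  then show ?case using x by simp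
qed auto

lemma sum_fixed_minus:
  "(\<Sum>x \<in> {(\<pi>, P) \<in> signed_involutions a (Suc b). \<pi> (Suc (a + b)) = Suc (a + b) \<and> Suc (a + b) \<notin> P}.
      weight (Suc (a + b)) x) = length_gen_poly a b" (is "sum _ ?S = _")
proof -
  have "?S = signed_involutions a b"
  proof (intro equalityI subsetI)
    fix x assume "x \<in> ?S"
    then obtain \<pi> P where x: "x = (\<pi>, P)" "(\<pi>, P) \<in> signed_involutions a (Suc b)"
      "\<pi> (Suc (a + b)) = Suc (a + b)" "Suc (a + b) \<notin> P" by auto
    then have "\<pi> permutes {1..a + b}"
      using signed_involutionsD(1)[of \<pi> P a "Suc b"] permutes_fixed_top_iff[of \<pi> "a + b"] by auto
    then show "x \<in> signed_involutions a b"
      using x fixed_minus_mem_iff[of a b P \<pi>] by auto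
  next
    fix x assume x: "x \<in> signed_involutions a b"
    obtain \<pi> P where x': "x = (\<pi>, P)" by (cases x)
    have \<pi>: "\<pi> permutes {1..a + b}" and P: "Suc (a + b) \<notin> P"
      using x x' signed_involutionsD(1,2)[of \<pi> P a b] by auto
    then show "x \<in> ?S"
      using x x' fixed_minus_mem_iff[of a b P \<pi>] permutes_fixed_top_iff[of \<pi> "a + b"] by auto
  qed
  moreover have "weight (Suc (a + b)) x = weight (a + b) x" if "x \<in> signed_involutions a b" for x
    using that by (cases x) (use inv_length_fixed_top[OF signed_involutionsD(1)] in simp)
  ultimately show ?thesis
    unfolding length_gen_poly_def by (metis (no_types, lifting) sum.cong)
qed

text \<open>The class is in bijection with the pairs of a partner \<open>i\<close> of the largest
  element and a smaller signed involution. By \<open>inv_length_insert\<close> the weight is a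
  product, so the sum factors.\<close>

lemma sum_matched:
  "(\<Sum>x \<in> {(\<pi>, P) \<in> signed_involutions (Suc a) (Suc b). \<pi> (Suc (Suc (a + b))) \<noteq> Suc (Suc (a + b))}.
      weight (Suc (Suc (a + b))) x)
   = (q_bracket (Suc (Suc (a + b))) - 1) * length_gen_poly a b" (is "sum _ ?S = _")
proof -
  define m where "m = a + b"
  have S: "cycle_insertion m i \<sigma>" if "(\<sigma>, Q) \<in> signed_involutions a b" "i \<in> {1..Suc m}" for \<sigma> Q i
  proof
    show "i \<in> {1..Suc m}" by fact
    show "\<sigma> (\<sigma> x) = x" for x using that by (simp add: signed_involutionsD(3))
    show "\<sigma> x = x" if "x \<notin> {1..m}" for x
      using that permutes_not_in[OF signed_involutionsD(1)[OF \<open>(\<sigma>, Q) \<in> _\<close>]] by (simp add: m_def)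
  qed
  have "(\<Sum>x \<in> ?S. weight (Suc (Suc m)) x)
    = (\<Sum>(i, y) \<in> {1..Suc m} \<times> signed_involutions a b. monom 1 (Suc (Suc m) - i) * weight m y)"
  proof (rule sum.reindex_bij_witness[where
      i = "\<lambda>(i, \<sigma>, Q). (insert_cycle m i \<sigma>, skip i ` Q)" and
      j = "\<lambda>(\<pi>, P). (\<pi> (Suc (Suc m)), delete_cycle m (\<pi> (Suc (Suc m))) \<pi>, unskip (\<pi> (Suc (Suc m))) ` P)"])
    fix x assume "x \<in> ?S"
    then obtain \<pi> P where x: "x = (\<pi>, P)" and mem: "(\<pi>, P) \<in> signed_involutions (Suc a) (Suc b)"
      and neq: "\<pi> (Suc (Suc m)) \<noteq> Suc (Suc m)" by (auto simp: m_def)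
    define i where "i = \<pi> (Suc (Suc m))"
    have \<pi>: "\<pi> permutes {1..Suc (Suc m)}" and inv: "\<And>x. \<pi> (\<pi> x) = x"
      using signed_involutionsD[OF mem] by (simp_all add: m_def)
    have i: "i \<in> {1..Suc m}"
      using neq permutes_in_image[OF \<pi>, of "Suc (Suc m)"] by (auto simp: i_def)
    have outside: "\<And>x. x \<notin> {1..Suc (Suc m)} \<Longrightarrow> \<pi> x = x"
      using permutes_not_in[OF \<pi>] .
    interpret ins: cycle_insertion m i "delete_cycle m i \<pi>"
      using inv outside i_def[symmetric] i by (rule delete_cycle(1))
    have del: "insert_cycle m i (delete_cycle m i \<pi>) = \<pi>"
      using inv outside i_def[symmetric] i by (rule delete_cycle(2))
    \<comment> \<open>Fixed points of an inserted involution lie in the range of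
      \<open>skip i\<close>, so \<open>unskip i\<close> loses nothing on \<open>P\<close>.\<close>
    have "P \<subseteq> fixed_points (Suc (Suc m)) (insert_cycle m i (delete_cycle m i \<pi>))"
      unfolding del using mem by (simp add: signed_involutions_def m_def)
    then have P: "skip i ` unskip i ` P = P"
      by (force simp: ins.fixed_points_insert image_iff)
    show "(case case x of (\<pi>, P) \<Rightarrow> (\<pi> (Suc (Suc m)), delete_cycle m (\<pi> (Suc (Suc m))) \<pi>,
            unskip (\<pi> (Suc (Suc m))) ` P) of
          (i, \<sigma>, Q) \<Rightarrow> (insert_cycle m i \<sigma>, skip i ` Q)) = x"
      using P by (simp add: x i_def[symmetric] del)
    have "(delete_cycle m i \<pi>, unskip i ` P) \<in> signed_involutions a b"
      using ins.insert_mem_signed_involutions_iff[OF m_def, of "unskip i ` P"] mem P by (simp add: del)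
    then show "(case x of (\<pi>, P) \<Rightarrow> (\<pi> (Suc (Suc m)), delete_cycle m (\<pi> (Suc (Suc m))) \<pi>,
            unskip (\<pi> (Suc (Suc m))) ` P)) \<in> {1..Suc m} \<times> signed_involutions a b"
      using i by (simp add: x i_def[symmetric])
    show "(case case x of (\<pi>, P) \<Rightarrow> (\<pi> (Suc (Suc m)), delete_cycle m (\<pi> (Suc (Suc m))) \<pi>,
            unskip (\<pi> (Suc (Suc m))) ` P) of
          (i, y) \<Rightarrow> monom 1 (Suc (Suc m) - i) * weight m y) = weight (Suc (Suc m)) x"
      using ins.inv_length_insert by (simp add: x i_def[symmetric] del mult_monom add.commute)
  next
    fix y assume "y \<in> {1..Suc m} \<times> signed_involutions a b"
    then obtain i \<sigma> Q where y: "y = (i, \<sigma>, Q)" and i: "i \<in> {1..Suc m}"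
      and mem: "(\<sigma>, Q) \<in> signed_involutions a b" by auto
    interpret ins: cycle_insertion m i \<sigma> using S mem i .
    \<comment> \<open>This is an equality of functions on all naturals; at \<open>Suc m\<close> it
      holds because both sides fix that point.\<close>
    have "delete_cycle m i (insert_cycle m i \<sigma>) = \<sigma>"
      using ins.outside[of "Suc m"] by (auto simp: delete_cycle_def)
    then show "(case case y of (i, \<sigma>, Q) \<Rightarrow> (insert_cycle m i \<sigma>, skip i ` Q) of
          (\<pi>, P) \<Rightarrow> (\<pi> (Suc (Suc m)), delete_cycle m (\<pi> (Suc (Suc m))) \<pi>,
            unskip (\<pi> (Suc (Suc m))) ` P)) = y"
      by (simp add: y image_image)
    show "(case y of (i, \<sigma>, Q) \<Rightarrow> (insert_cycle m i \<sigma>, skip i ` Q)) \<in> ?S"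
      using ins.insert_mem_signed_involutions_iff[OF m_def, of Q] mem i
      by (auto simp: y m_def[symmetric])
  qed
  also have "\<dots> = (\<Sum>i \<in> {1..Suc m}. monom 1 (Suc (Suc m) - i)) * length_gen_poly a b"
    by (simp only: sum.cartesian_product[symmetric] sum_product length_gen_poly_def m_def[symmetric])
  also have "(\<Sum>i \<in> {1..Suc m}. monom (1::int) (Suc (Suc m) - i)) = (\<Sum>j \<in> {1..Suc m}. monom 1 j)"
    by (rule sum.reindex_bij_witness[where i = "\<lambda>j. Suc (Suc m) - j" and j = "\<lambda>j. Suc (Suc m) - j"])
      auto
  \<comment> \<open>The exponents run from \<open>1\<close> to \<open>Suc m\<close>;
    \<open>q_bracket\<close> also contains the exponent \<open>0\<close>, whose term is the
    subtracted \<open>1\<close>.\<close>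
  also have "\<dots> = q_bracket (Suc (Suc m)) - 1"
    unfolding q_bracket_def sum.lessThan_Suc_shift[of _ "Suc m"]
    by (simp add: sum.atLeast1_atMost_eq one_pCons monom_0)
  finally show ?thesis by (simp add: m_def)
qed

theorem theorem7p6:
  fixes p q :: nat
  assumes "p > 0" and "q > 0"
  shows "length_gen_poly p q =
    length_gen_poly (p - 1) q + length_gen_poly p (q - 1)
      + (q_bracket (p + q) - 1) * length_gen_poly (p - 1) (q - 1)"
proof -
  obtain a b where p: "p = Suc a" and q: "q = Suc b"
    using assms by (metis gr0_implies_Suc)
  define n where "n = p + q"
  define S where "S = signed_involutions p q"
  \<comment> \<open>Removing the largest element lowers the first parameter in \<open>S1\<close>,
    the second in \<open>S2\<close>, and both in \<open>S3\<close>.\<close>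
  define S1 where "S1 = {(\<pi>, P) \<in> S. \<pi> n = n \<and> n \<in> P}"
  define S2 where "S2 = {(\<pi>, P) \<in> S. \<pi> n = n \<and> n \<notin> P}"
  define S3 where "S3 = {(\<pi>, P) \<in> S. \<pi> n \<noteq> n}"
  have fin: "finite S1" "finite S2" "finite S3"
    using finite_signed_involutions[of p q]
    by (auto simp: S_def S1_def S2_def S3_def elim: rev_finite_subset)
  have "S = S1 \<union> (S2 \<union> S3)" "S1 \<inter> (S2 \<union> S3) = {}" "S2 \<inter> S3 = {}"
    by (auto simp: S1_def S2_def S3_def)
  then have "sum (weight n) S = sum (weight n) S1 + (sum (weight n) S2 + sum (weight n) S3)"
    using fin by (simp add: sum.union_disjoint)
  moreover have "sum (weight n) S1 = length_gen_poly (p - 1) q"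
    using sum_fixed_plus[of a q] by (simp add: S1_def S_def n_def p)
  moreover have "sum (weight n) S2 = length_gen_poly p (q - 1)"
    using sum_fixed_minus[of p b] by (simp add: S2_def S_def n_def q)
  moreover have "sum (weight n) S3 = (q_bracket n - 1) * length_gen_poly (p - 1) (q - 1)"
    using sum_matched[of a b] by (simp add: S3_def S_def n_def p q)
  ultimately show ?thesis
    by (simp add: length_gen_poly_def[of p q] S_def n_def)
qed

end
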